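(* Let $\mathcal{H}$ be a separable infinite dimensional complex Hilbert space with orthonormal basis $\{e_j\}$, let $p\in\mathcal{B}(\mathcal{H})$ be a projection, and let $d_j=\langle pe_j,e_j\rangle$ be its diagonal with respect to $\{e_j\}$. Put $$a=\sum_{d_j\le 1/2} d_j,\qquad b=\sum_{d_j>1/2}(1-d_j),$$ and let $q$ be the projection onto $\overline{\operatorname{span}}\{e_j\mid d_j>1/2\}$. If $a+b<\infty$, then $p-q\in\mathcal{L}^2$ and $a-b=[p:q]$.
   Context: Projections are orthogonal (selfadjoint) projections. $\mathcal{L}^2$ is the ideal of Hilbert--Schmidt operators on $\mathcal{H}$. A pair $(p,q)$ of projections is a Fredholm pair if $q|_{p\mathcal{H}}$, viewed as an operator in $\mathcal{B}(p\mathcal{H},q\mathcal{H})$, is Fredholm, and then the essential codimension is $[p:q]:=\operatorname{ind}(q|_{p\mathcal{H}})$, where $\operatorname{ind}(x)=\dim\ker x-\dim\ker x^*$. If $p-q$ is compact, then $(p,q)$ is a Fredholm pair and $[p:q]$ coincides with the Brown--Douglas--Fillmore essential codimension: $[p:q]=\operatorname{Tr}(p)-\operatorname{Tr}(q)$ if both traces are finite, and $[p:q]=\operatorname{ind}(v^*w)$ if both traces are infinite, where $w,v$ are any isometries with $ww^*=p$, $vv^*=q$. *)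

theory Defs
  imports "HOL-Analysis.Analysis"
begin

section \<open>Complex Hilbert spaces\<close>

text \<open>
  The distribution has only real inner product spaces. A complex Hilbert space is a complete
  real one, with a compatible complex scalar multiplication and a sesquilinear form
  (linear in the first argument) whose real part is the real inner product. In particular
  \<open>norm x = sqrt (Re (cinner x x))\<close>, and norm and topology are those of the library.
\<close>

class chilbert_space = real_inner + banach +
  fixes scaleC :: "complex \<Rightarrow> 'a \<Rightarrow> 'a" (infixr "*\<^sub>C" 75)
    and cinner :: "'a \<Rightarrow> 'a \<Rightarrow> complex"
  assumes scaleC_add_right: "c *\<^sub>C (x + y) = c *\<^sub>C x + c *\<^sub>C y"
    and scaleC_add_left: "(c + d) *\<^sub>C x = c *\<^sub>C x + d *\<^sub>C x"
    and scaleC_scaleC: "c *\<^sub>C (d *\<^sub>C x) = (c * d) *\<^sub>C x"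
    and scaleC_of_real: "complex_of_real r *\<^sub>C x = r *\<^sub>R x"
    and cinner_add_left: "cinner (x + y) z = cinner x z + cinner y z"
    and cinner_scaleC_left: "cinner (c *\<^sub>C x) y = c * cinner x y"
    and cinner_commute: "cinner x y = cnj (cinner y x)"
    and Re_cinner: "Re (cinner x y) = inner x y"

lemma scaleC_one: "1 *\<^sub>C x = (x :: 'a::chilbert_space)"
  using scaleC_of_real[of 1 x] by simp

global_interpretation complex_vector:
  vector_space "scaleC :: complex \<Rightarrow> 'a \<Rightarrow> 'a::chilbert_space"
  defines cspan = complex_vector.span
    and cdim = complex_vector.dim
    and csubspace = complex_vector.subspace
    and cdependent = complex_vector.dependent
    and crepresentation = complex_vector.representation
    and cextend_basis = complex_vector.extend_basis
  by unfold_locales (simp_all add: scaleC_add_right scaleC_add_left scaleC_scaleC scaleC_one)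

text \<open>The library's \<open>dim\<close> is \<open>0\<close> on infinite dimensional sets, hence a separate predicate.\<close>

definition cfinite_dim :: "'a::chilbert_space set \<Rightarrow> bool" where
  "cfinite_dim V \<longleftrightarrow> (\<exists>B. finite B \<and> V \<subseteq> cspan B)"

definition orthonormal_basis :: "'a::chilbert_space set \<Rightarrow> bool" where
  "orthonormal_basis B \<longleftrightarrow>
     (\<forall>x\<in>B. \<forall>y\<in>B. cinner x y = (if x = y then 1 else 0)) \<and> closure (cspan B) = UNIV"


section \<open>Operators\<close>

definition bounded_clinear :: "('a::chilbert_space \<Rightarrow> 'a) \<Rightarrow> bool" where
  "bounded_clinear T \<longleftrightarrow> bounded_linear T \<and> (\<forall>c x. T (c *\<^sub>C x) = c *\<^sub>C T x)"

definition projection :: "('a::chilbert_space \<Rightarrow> 'a) \<Rightarrow> bool" where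
  "projection p \<longleftrightarrow> bounded_clinear p \<and> (\<forall>x. p (p x) = p x) \<and>
     (\<forall>x y. cinner (p x) y = cinner x (p y))"

text \<open>The sum below does not depend on the choice of the orthonormal basis.\<close>

definition hilbert_schmidt :: "('a::chilbert_space \<Rightarrow> 'a) \<Rightarrow> bool" where
  "hilbert_schmidt T \<longleftrightarrow> bounded_clinear T \<and>
     (\<exists>B. orthonormal_basis B \<and> (\<lambda>x. (norm (T x))\<^sup>2) summable_on B)"


section \<open>Fredholm operators between closed subspaces\<close>

text \<open>
  An operator in \<open>\<B>(M,N)\<close>, for closed subspaces \<open>M\<close> and \<open>N\<close> of the same Hilbert space, is
  represented by a function on the whole space of which only the values on \<open>M\<close> matter.
  Its adjoint is an operator in \<open>\<B>(N,M)\<close>; on \<open>N\<close>, \<open>adjoint_on M T\<close> agrees with it.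
\<close>

definition bounded_clinear_on ::
    "'a::chilbert_space set \<Rightarrow> 'a set \<Rightarrow> ('a \<Rightarrow> 'a) \<Rightarrow> bool" where
  "bounded_clinear_on M N T \<longleftrightarrow>
     (\<forall>x\<in>M. T x \<in> N) \<and>
     (\<forall>x\<in>M. \<forall>y\<in>M. T (x + y) = T x + T y) \<and>
     (\<forall>c. \<forall>x\<in>M. T (c *\<^sub>C x) = c *\<^sub>C T x) \<and>
     (\<exists>K. \<forall>x\<in>M. norm (T x) \<le> K * norm x)"

definition adjoint_on :: "'a::chilbert_space set \<Rightarrow> ('a \<Rightarrow> 'a) \<Rightarrow> 'a \<Rightarrow> 'a" where
  "adjoint_on M T y = (THE z. z \<in> M \<and> (\<forall>x\<in>M. cinner (T x) y = cinner x z))"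

definition kernel_on :: "'a::chilbert_space set \<Rightarrow> ('a \<Rightarrow> 'a) \<Rightarrow> 'a set" where
  "kernel_on M T = {x \<in> M. T x = 0}"

definition fredholm_on :: "'a::chilbert_space set \<Rightarrow> 'a set \<Rightarrow> ('a \<Rightarrow> 'a) \<Rightarrow> bool" where
  "fredholm_on M N T \<longleftrightarrow> bounded_clinear_on M N T \<and> closed (T ` M) \<and>
     cfinite_dim (kernel_on M T) \<and> cfinite_dim (kernel_on N (adjoint_on M T))"

definition index_on :: "'a::chilbert_space set \<Rightarrow> 'a set \<Rightarrow> ('a \<Rightarrow> 'a) \<Rightarrow> int" where
  "index_on M N T =
     int (cdim (kernel_on M T)) - int (cdim (kernel_on N (adjoint_on M T)))"

definition fredholm_pair :: "('a::chilbert_space \<Rightarrow> 'a) \<Rightarrow> ('a \<Rightarrow> 'a) \<Rightarrow> bool" where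
  "fredholm_pair p q \<longleftrightarrow> projection p \<and> projection q \<and> fredholm_on (range p) (range q) q"

text \<open>Meaningful only for Fredholm pairs.\<close>

definition ess_codim :: "('a::chilbert_space \<Rightarrow> 'a) \<Rightarrow> ('a \<Rightarrow> 'a) \<Rightarrow> int" where
  "ess_codim p q = index_on (range p) (range q) q"

end

theory Submission
  imports Defs
begin

text \<open>
  Write \<open>C = p - q\<close> and \<open>S = 1 - p - q\<close>. Then \<open>C\<^sup>2 + S\<^sup>2 = 1\<close> and \<open>CS = - SC\<close>, and
  \<open>C\<^sup>2\<close> commutes with both projections. The basis \<open>e\<close> diagonalises \<open>q\<close>, so on basis vectors
  with \<open>q e\<^sub>j = 0\<close> the number \<open>\<parallel>C e\<^sub>j\<parallel>\<^sup>2\<close> is \<open>d\<^sub>j\<close>, and on those with \<open>q e\<^sub>j = e\<^sub>j\<close> it is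
  \<open>1 - d\<^sub>j\<close>. Hence \<open>a + b\<close> is the squared Hilbert--Schmidt norm of \<open>C\<close>, and
  \<open>a - b = Tr ((1 - 2q) C\<^sup>2)\<close>. The operator \<open>C\<close> itself need not be trace class,
  whereas \<open>C\<^sup>2\<close> is.

  On an eigenspace of \<open>C\<^sup>2\<close> for an eigenvalue strictly between 0 and 1 the projection \<open>q\<close> has rank
  equal to half of the dimension, so that only the eigenvalue 1 contributes to this trace. Its
  eigenspace is \<open>(ran p \<inter> ker q) \<oplus> (ker p \<inter> ran q)\<close>, and it contributes the difference of
  the two dimensions, which is the index of \<open>q\<close> as an operator from \<open>ran p\<close> to \<open>ran q\<close>.

  The proof realises this without a spectral theorem. The trace \<open>Tr ((1 - 2q) C\<^bsup>2n\<^esup>)\<close> is the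
  same for all \<open>n \<ge> 1\<close> (\<open>weight_telescope\<close>), because the difference of two consecutive ones
  compares, after polarisation, squared Hilbert--Schmidt norms of operators and of their adjoints. As \<open>n\<close>
  grows, \<open>C\<^bsup>2n\<^esup>\<close> converges strongly to the projection \<open>E\<close> onto the fixed vectors of
  \<open>C\<^sup>2\<close> (\<open>fix_proj_tendsto\<close>). Dominated convergence gives \<open>a - b = Tr ((1 - q) E) - Tr (q E)\<close>,
  and for a projection the trace is the dimension of the range (\<open>projection_trace_dim\<close>).

  For the Fredholm property the missing part is that \<open>q\<close> maps \<open>ran p\<close> onto a closed set. For \<open>x\<close> in
  \<open>ran p\<close> one has \<open>\<parallel>q x\<parallel>\<^sup>2 = \<parallel>x\<parallel>\<^sup>2 - \<parallel>C x\<parallel>\<^sup>2\<close>, so it suffices that 1 is isolated in the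
  spectrum of \<open>C\<^sup>2\<close>. This holds since the Hilbert--Schmidt norms of the operators \<open>C\<^sup>n (1 - E)\<close>
  tend to 0 (\<open>spectral_gap\<close>).
\<close>

section \<open>The complex inner product\<close>

lemma cinner_add_right: "cinner x (y + z) = cinner x y + cinner (x :: 'a::chilbert_space) z"
  by (metis cinner_add_left cinner_commute complex_cnj_add)

lemma cinner_scaleC_right: "cinner x (c *\<^sub>C y) = cnj c * cinner (x :: 'a::chilbert_space) y"
  by (metis cinner_scaleC_left cinner_commute complex_cnj_mult)

lemma cinner_zero_left [simp]: "cinner 0 (y :: 'a::chilbert_space) = 0"
  using cinner_add_left[of 0 0 y] by simp

lemma cinner_zero_right [simp]: "cinner (y :: 'a::chilbert_space) 0 = 0"
  using cinner_add_right[of y 0 0] by simp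

lemma cinner_diff_left: "cinner (x - y) z = cinner x z - cinner (y :: 'a::chilbert_space) z"
  using cinner_add_left[of "x - y" y z] by simp

lemma cinner_diff_right: "cinner z (x - y) = cinner z x - cinner z (y :: 'a::chilbert_space)"
  using cinner_add_right[of z "x - y" y] by simp

lemma cinner_minus_right: "cinner z (- x) = - cinner z (x :: 'a::chilbert_space)"
  using cinner_diff_right[of z 0 x] by simp

lemma cinner_sum_left: "cinner (sum f F) z = (\<Sum>i\<in>F. cinner (f i) (z :: 'a::chilbert_space))"
  by (induction F rule: infinite_finite_induct) (simp_all add: cinner_add_left)

lemma cinner_sum_right: "cinner z (sum f F) = (\<Sum>i\<in>F. cinner (z :: 'a::chilbert_space) (f i))"
  by (induction F rule: infinite_finite_induct) (simp_all add: cinner_add_right)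

lemma cinner_self: "cinner x x = complex_of_real ((norm (x :: 'a::chilbert_space))\<^sup>2)"
proof (rule complex_eqI)
  show "Re (cinner x x) = Re (complex_of_real ((norm x)\<^sup>2))"
    by (simp add: Re_cinner power2_norm_eq_inner)
  have "Im (cinner x x) = Im (cnj (cinner x x))"
    using cinner_commute[of x x] by simp
  then show "Im (cinner x x) = Im (complex_of_real ((norm x)\<^sup>2))" by simp
qed

lemma cinner_ext:
  assumes "\<And>z. cinner x z = cinner (y :: 'a::chilbert_space) z"
  shows "x = y"
proof -
  have "cinner (x - y) (x - y) = 0" using assms by (simp add: cinner_diff_left)
  then show ?thesis by (simp add: cinner_self)
qed

lemma norm_scaleC: "norm (c *\<^sub>C x) = cmod c * norm (x :: 'a::chilbert_space)"
proof -
  have "cinner (c *\<^sub>C x) (c *\<^sub>C x) = (c * cnj c) * cinner x x"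
    by (simp add: cinner_scaleC_left cinner_scaleC_right)
  then have "complex_of_real ((norm (c *\<^sub>C x))\<^sup>2) = complex_of_real ((cmod c * norm x)\<^sup>2)"
    unfolding cinner_self complex_norm_square[symmetric] by (simp add: power_mult_distrib)
  then have "(norm (c *\<^sub>C x))\<^sup>2 = (cmod c * norm x)\<^sup>2"
    using of_real_eq_iff by blast
  then show ?thesis by (simp add: power2_eq_iff_nonneg)
qed

section \<open>Orthonormal expansions\<close>

definition orthonormal :: "'a::chilbert_space set \<Rightarrow> bool" where
  "orthonormal F \<longleftrightarrow> (\<forall>x\<in>F. \<forall>y\<in>F. cinner x y = (if x = y then 1 else 0))"

definition partial_expansion :: "'a::chilbert_space set \<Rightarrow> 'a \<Rightarrow> 'a" where
  "partial_expansion F x = (\<Sum>f\<in>F. cinner x f *\<^sub>C f)"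

lemma orthonormal_subset: "orthonormal F \<Longrightarrow> G \<subseteq> F \<Longrightarrow> orthonormal G"
  unfolding orthonormal_def by blast

lemma orthonormal_norm: "orthonormal F \<Longrightarrow> f \<in> F \<Longrightarrow> norm f = 1"
  using cinner_self[of f] unfolding orthonormal_def
  by (metis norm_ge_zero of_real_eq_1_iff power2_eq_1_iff zero_le_one one_neq_neg_one
      neg_0_le_iff_le not_one_le_zero)

lemma cinner_expansion:
  assumes "orthonormal F" "finite F" "f \<in> F"
  shows "cinner (\<Sum>g\<in>F. u g *\<^sub>C g) f = u f"
proof -
  have "cinner (\<Sum>g\<in>F. u g *\<^sub>C g) f = (\<Sum>g\<in>F. if g = f then u g else 0)"
    unfolding cinner_sum_left
    by (intro sum.cong) (use assms in \<open>auto simp: cinner_scaleC_left orthonormal_def\<close>)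
  then show ?thesis using assms by simp
qed

lemma orthonormal_independent:
  assumes "orthonormal F" "finite F"
  shows "\<not> cdependent F"
  unfolding complex_vector.independent_explicit_finite_subsets
proof (intro allI impI ballI)
  fix S u v
  assume S: "S \<subseteq> F" "finite S" "(\<Sum>v\<in>S. u v *\<^sub>C v) = 0" "v \<in> S"
  then show "u v = 0"
    using cinner_expansion[OF orthonormal_subset[OF assms(1) S(1)] S(2) S(4), of u] by simp
qed

lemma residual_orthogonal:
  assumes "orthonormal F" "finite F" "y \<in> cspan F"
  shows "cinner (x - partial_expansion F x) y = 0"
proof -
  obtain u where u: "y = (\<Sum>v\<in>F. u v *\<^sub>C v)"
    using assms(3) complex_vector.span_finite[OF assms(2)] by auto
  have "cinner (x - partial_expansion F x) f = 0" if "f \<in> F" for f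
    using cinner_expansion[OF assms(1,2) that]
    by (simp add: cinner_diff_left partial_expansion_def)
  then show ?thesis
    by (simp add: u cinner_sum_right cinner_scaleC_right)
qed

lemma norm_add_orthogonal:
  assumes "cinner x y = 0"
  shows "(norm (x + y))\<^sup>2 = (norm x)\<^sup>2 + (norm (y :: 'a::chilbert_space))\<^sup>2"
proof -
  have "inner x y = 0" using assms by (simp flip: Re_cinner)
  then show ?thesis by (simp add: power2_norm_eq_inner inner_add_left inner_add_right inner_commute)
qed

lemma partial_expansion_span: "partial_expansion F x \<in> cspan F"
  unfolding partial_expansion_def
  by (intro complex_vector.span_sum complex_vector.span_scale complex_vector.span_base)

text \<open>
  The residual is orthogonal to the expansion, whose squared norm is the sum of the squared coefficients.
\<close>

lemma norm_residual:
  assumes "orthonormal F" "finite F"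
  shows "(norm (x - partial_expansion F x))\<^sup>2 = (norm x)\<^sup>2 - (\<Sum>f\<in>F. (cmod (cinner x f))\<^sup>2)"
proof -
  let ?P = "partial_expansion F x"
  have "complex_of_real ((norm ?P)\<^sup>2) = (\<Sum>f\<in>F. cinner x f * cinner f ?P)"
    unfolding cinner_self[symmetric]
    by (subst (1) partial_expansion_def) (simp add: cinner_sum_left cinner_scaleC_left)
  also have "\<dots> = (\<Sum>f\<in>F. cinner x f * cnj (cinner x f))"
  proof (intro sum.cong refl)
    fix f assume "f \<in> F"
    then have "cinner ?P f = cinner x f"
      using cinner_expansion[OF assms] unfolding partial_expansion_def by blast
    then show "cinner x f * cinner f ?P = cinner x f * cnj (cinner x f)"
      using cinner_commute[of f ?P] by simp
  qed
  also have "\<dots> = complex_of_real (\<Sum>f\<in>F. (cmod (cinner x f))\<^sup>2)"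
    unfolding of_real_sum by (intro sum.cong refl) (metis complex_norm_square)
  finally have P: "(norm ?P)\<^sup>2 = (\<Sum>f\<in>F. (cmod (cinner x f))\<^sup>2)"
    using of_real_eq_iff by blast
  have "(norm ((x - ?P) + ?P))\<^sup>2 = (norm (x - ?P))\<^sup>2 + (norm ?P)\<^sup>2"
    by (intro norm_add_orthogonal residual_orthogonal assms partial_expansion_span)
  then show ?thesis using P by simp
qed

lemma bessel_inequality:
  assumes "orthonormal F" "finite F"
  shows "(\<Sum>f\<in>F. (cmod (cinner x f))\<^sup>2) \<le> (norm x)\<^sup>2"
  using norm_residual[OF assms, of x] zero_le_power2[of "norm (x - partial_expansion F x)"] by linarith

lemma partial_expansion_best:
  assumes "orthonormal F" "finite F" "y \<in> cspan F"
  shows "norm (x - partial_expansion F x) \<le> norm (x - y)"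
proof -
  let ?P = "partial_expansion F x"
  have "?P - y \<in> cspan F"
    by (intro complex_vector.span_diff partial_expansion_span assms)
  then have "(norm ((x - ?P) + (?P - y)))\<^sup>2 = (norm (x - ?P))\<^sup>2 + (norm (?P - y))\<^sup>2"
    by (intro norm_add_orthogonal residual_orthogonal assms)
  then have "(norm (x - ?P))\<^sup>2 \<le> (norm (x - y))\<^sup>2" by simp
  then show ?thesis by (simp add: power2_le_iff_abs_le)
qed

lemma orthonormal_basis_orthonormal: "orthonormal_basis B \<Longrightarrow> orthonormal B"
  by (simp add: orthonormal_basis_def orthonormal_def)

text \<open>
  Bessel bounds the sum by the squared norm. For the converse, an element of the span near \<open>x\<close>
  uses only finitely many basis vectors, and the expansion of \<open>x\<close> in these is at least as
  close to \<open>x\<close>.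
\<close>

lemma parseval_identity:
  assumes "orthonormal_basis B"
  shows "((\<lambda>b. (cmod (cinner x b))\<^sup>2) has_sum (norm x)\<^sup>2) B"
proof -
  let ?f = "\<lambda>b. (cmod (cinner x b))\<^sup>2"
  note on = orthonormal_basis_orthonormal[OF assms]
  have le: "sum ?f F \<le> (norm x)\<^sup>2" if "F \<subseteq> B" "finite F" for F
    using bessel_inequality[OF orthonormal_subset[OF on]] that by blast
  have "bdd_above (sum ?f ` {F. F \<subseteq> B \<and> finite F})"
    using le by (intro bdd_aboveI[of _ "(norm x)\<^sup>2"]) auto
  then have s: "?f summable_on B"
    by (intro nonneg_bdd_above_summable_on) auto
  have up: "infsum ?f B \<le> (norm x)\<^sup>2"
    using s le by (intro infsum_le_finite_sums) auto
  have "(norm x)\<^sup>2 \<le> infsum ?f B + \<epsilon>" if "\<epsilon> > 0" for \<epsilon>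
  proof -
    have "x \<in> closure (cspan B)" using assms by (simp add: orthonormal_basis_def)
    then have "\<exists>y\<in>cspan B. dist y x < sqrt \<epsilon>"
      using that unfolding closure_approachable by simp
    then obtain y where y: "y \<in> cspan B" "dist y x < sqrt \<epsilon>" by blast
    obtain F r where F: "finite F" "F \<subseteq> B" "y = (\<Sum>a\<in>F. r a *\<^sub>C a)"
      using y(1) unfolding complex_vector.span_explicit by auto
    have yF: "y \<in> cspan F"
      unfolding F by (intro complex_vector.span_sum complex_vector.span_scale complex_vector.span_base)
    note onF = orthonormal_subset[OF on F(2)]
    have "(norm (x - partial_expansion F x))\<^sup>2 \<le> (sqrt \<epsilon>)\<^sup>2"
      using partial_expansion_best[OF onF F(1) yF, of x] y(2)
      by (intro power_mono) (auto simp: dist_norm norm_minus_commute)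
    then have "(norm x)\<^sup>2 \<le> sum ?f F + \<epsilon>"
      using norm_residual[OF onF F(1), of x] that by simp
    also have "sum ?f F \<le> infsum ?f B"
      using s F by (intro finite_sum_le_infsum) auto
    finally show ?thesis by simp
  qed
  then have "(norm x)\<^sup>2 \<le> infsum ?f B" by (rule field_le_epsilon)
  with up s show ?thesis by (simp add: has_sum_iff)
qed

section \<open>Hilbert--Schmidt norms and traces of projections\<close>

lemma has_sum_diff:
  fixes f g :: "'a \<Rightarrow> real"
  assumes "(f has_sum s) A" and "(g has_sum t) A"
  shows "((\<lambda>x. f x - g x) has_sum (s - t)) A"
  using has_sum_add[OF assms(1) has_sum_uminusI[OF assms(2)]] by simp

lemma has_sum_exchange_nonneg:
  fixes f :: "'a \<Rightarrow> 'b \<Rightarrow> real"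
  assumes "\<And>x. x \<in> A \<Longrightarrow> (f x has_sum g x) B"
    and "\<And>y. y \<in> B \<Longrightarrow> ((\<lambda>x. f x y) has_sum h y) A"
    and "(g has_sum s) A"
    and "\<And>x y. x \<in> A \<Longrightarrow> y \<in> B \<Longrightarrow> 0 \<le> f x y"
  shows "(h has_sum s) B"
proof -
  let ?f = "\<lambda>(x, y). f x y"
  have "?f summable_on A \<times> B"
    using assms by (intro summable_on_SigmaI[where g = g]) (auto simp: summable_on_def)
  then have "(?f has_sum s) (A \<times> B)"
    using assms by (intro has_sum_SigmaI[where g = g]) auto
  then have "((\<lambda>(x, y). ?f (y, x)) has_sum s) (B \<times> A)"
    by (simp add: has_sum_swap[of ?f])
  then show ?thesis
    by (rule has_sum_SigmaD) (use assms in auto)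
qed

text \<open>
  By Parseval both sides are the double sum of \<open>\<bar>\<langle>X b, c\<rangle>\<bar>\<^sup>2\<close> over basis vectors \<open>b\<close> and \<open>c\<close>,
  summed in the two possible orders.
\<close>

lemma hilbert_schmidt_norm_adjoint:
  fixes X Y :: "'a::chilbert_space \<Rightarrow> 'a"
  assumes "orthonormal_basis B"
    and adj: "\<And>x y. cinner (X x) y = cinner x (Y y)"
    and "((\<lambda>b. (norm (X b))\<^sup>2) has_sum s) B"
  shows "((\<lambda>b. (norm (Y b))\<^sup>2) has_sum s) B"
proof (rule has_sum_exchange_nonneg)
  show "((\<lambda>c. (cmod (cinner (X b) c))\<^sup>2) has_sum (norm (X b))\<^sup>2) B" for b
    by (rule parseval_identity[OF assms(1)])
  have "cmod (cinner (X b) c) = cmod (cinner (Y c) b)" for b c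
    using cinner_commute[of b "Y c"] by (simp add: adj)
  then show "((\<lambda>b. (cmod (cinner (X b) c))\<^sup>2) has_sum (norm (Y c))\<^sup>2) B" for c
    using parseval_identity[OF assms(1), of "Y c"] by simp
qed (use assms in auto)

text \<open>
  Cauchy--Schwarz for the complex form, as Bessel's inequality for the single vector
  \<open>y / \<parallel>y\<parallel>\<close>.
\<close>

lemma cinner_bound: "cmod (cinner x y) \<le> norm x * norm (y :: 'a::chilbert_space)"
proof (cases "y = 0")
  case False
  define u where "u = (1 / complex_of_real (norm y)) *\<^sub>C y"
  have "norm u = 1" using False by (simp add: u_def norm_scaleC norm_divide)
  then have "orthonormal {u}" by (simp add: orthonormal_def cinner_self)
  then have "(cmod (cinner x u))\<^sup>2 \<le> (norm x)\<^sup>2" using bessel_inequality[of "{u}" x] by simp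
  then have "cmod (cinner x u) \<le> norm x" by (simp add: power2_le_iff_abs_le)
  moreover have "cmod (cinner x u) = cmod (cinner x y) / norm y"
    by (simp add: u_def cinner_scaleC_right norm_mult norm_divide)
  ultimately show ?thesis using False by (simp add: field_simps)
qed simp

text \<open>
  The coefficients of \<open>X x\<close> are \<open>\<langle>x, Y b\<rangle>\<close>, so Cauchy--Schwarz bounds the sum of their squares by
  the squared Hilbert--Schmidt norm of the adjoint.
\<close>

lemma norm_le_hilbert_schmidt_norm:
  fixes X Y :: "'a::chilbert_space \<Rightarrow> 'a"
  assumes "orthonormal_basis B"
    and adj: "\<And>x y. cinner (X x) y = cinner x (Y y)"
    and s: "((\<lambda>b. (norm (X b))\<^sup>2) has_sum s) B"
  shows "(norm (X x))\<^sup>2 \<le> s * (norm x)\<^sup>2"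
proof (rule has_sum_mono)
  show "((\<lambda>b. (cmod (cinner (X x) b))\<^sup>2) has_sum (norm (X x))\<^sup>2) B"
    by (rule parseval_identity[OF assms(1)])
  show "((\<lambda>b. (norm (Y b))\<^sup>2 * (norm x)\<^sup>2) has_sum s * (norm x)\<^sup>2) B"
    using hilbert_schmidt_norm_adjoint[OF assms] by (rule has_sum_cmult_left)
  show "(cmod (cinner (X x) b))\<^sup>2 \<le> (norm (Y b))\<^sup>2 * (norm x)\<^sup>2" for b
    unfolding adj power_mult_distrib[symmetric]
    using cinner_bound[of x "Y b"] by (intro power_mono) (auto simp: mult.commute)
qed

text \<open>
  This is the dominated convergence theorem for the counting measure.
\<close>

lemma dominated_convergence_has_sum:
  fixes f :: "nat \<Rightarrow> 'b \<Rightarrow> real"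
  assumes s: "\<And>n. (f n has_sum s n) A"
    and bound: "\<And>n x. x \<in> A \<Longrightarrow> \<bar>f n x\<bar> \<le> g x"
    and g: "g summable_on A"
    and lim: "\<And>x. x \<in> A \<Longrightarrow> (\<lambda>n. f n x) \<longlonglongrightarrow> h x"
  shows "h summable_on A" and "s \<longlonglongrightarrow> infsum h A"
proof -
  have abs_g: "\<And>x. x \<in> A \<Longrightarrow> \<bar>g x\<bar> = g x" using bound by fastforce
  then have "(\<lambda>x. norm (g x)) summable_on A"
    using g by (subst summable_on_cong[of _ _ g]) auto
  then have g': "Infinite_Set_Sum.abs_summable_on g A"
    using abs_summable_equivalent[of g A] by simp
  have hle: "\<bar>h x\<bar> \<le> g x" if "x \<in> A" for x
    using tendsto_rabs[OF lim[OF that]] bound[OF that] by (intro LIMSEQ_le_const2) auto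
  have le: "Infinite_Set_Sum.abs_summable_on k A" if "\<And>x. x \<in> A \<Longrightarrow> \<bar>k x\<bar> \<le> g x" for k
    using g' by (rule abs_summable_on_comparison_test) (use that abs_g in auto)
  have fs: "Infinite_Set_Sum.abs_summable_on (f n) A" for n by (rule le[OF bound])
  have hs: "Infinite_Set_Sum.abs_summable_on h A" by (rule le[OF hle])
  show "h summable_on A"
    by (rule abs_summable_summable[OF abs_summable_equivalent[THEN iffD2, OF hs]])
  have "(\<lambda>n. infsetsum (f n) A) \<longlonglongrightarrow> infsetsum h A"
    unfolding infsetsum_def
    by (rule integral_dominated_convergence[where w = g])
       (use g' lim bound in \<open>auto simp: Infinite_Set_Sum.abs_summable_on_def AE_count_space\<close>)
  moreover have "infsetsum (f n) A = s n" for n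
    using infsetsum_infsum[OF fs[of n]] s[of n] by (simp add: infsumI)
  ultimately show "s \<longlonglongrightarrow> infsum h A"
    using infsetsum_infsum[OF hs] by simp
qed

lemma projection_norm: "projection G \<Longrightarrow> complex_of_real ((norm (G x))\<^sup>2) = cinner (G x) x"
  unfolding cinner_self[symmetric] projection_def by metis

text \<open>
  For a finite orthonormal set \<open>F\<close> in the range, the sum over \<open>b\<close> of the squared coefficients of
  \<open>G b\<close> with respect to \<open>F\<close> is \<open>card F\<close>, by Parseval. Bessel's inequality turns this into
  \<open>card F \<le> t\<close>, so there is an \<open>F\<close> of maximal size. It is a basis of the range, and then Bessel's
  inequality is an equality.
\<close>

lemma projection_trace_dim:
  assumes B: "orthonormal_basis B" and G: "projection G"
    and t: "((\<lambda>b. (norm (G b))\<^sup>2) has_sum t) B"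
  shows "cfinite_dim (range G)" and "t = real (cdim (range G))"
proof -
  have GG: "G (G x) = G x" and Gs: "cinner (G x) y = cinner x (G y)" for x y
    using G unfolding projection_def by auto
  have Gd: "G (x - y) = G x - G y" and Gsc: "G (c *\<^sub>C x) = c *\<^sub>C G x" for x y c
    using G unfolding projection_def bounded_clinear_def by (auto simp: linear_diff bounded_linear.linear)
  have sum: "((\<lambda>b. \<Sum>f\<in>F. (cmod (cinner (G b) f))\<^sup>2) has_sum real (card F)) B"
    if F: "orthonormal F" "finite F" "F \<subseteq> range G" for F
  proof -
    have one: "((\<lambda>b. (cmod (cinner (G b) f))\<^sup>2) has_sum 1) B" if f: "f \<in> F" for f
    proof -
      from f have "cmod (cinner (G b) f) = cmod (cinner f b)" for b
        using F(3) GG Gs cinner_commute[of f b] by (auto simp: complex_mod_cnj)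
      then show "((\<lambda>b. (cmod (cinner (G b) f))\<^sup>2) has_sum 1) B"
        using parseval_identity[OF B, of f] orthonormal_norm[OF F(1) f] by simp
    qed
    from F(2) one show ?thesis
      by (induction F rule: finite_induct) (auto intro!: has_sum_add)
  qed
  have card_le: "real (card F) \<le> t" if F: "orthonormal F" "finite F" "F \<subseteq> range G" for F
    by (rule has_sum_mono[OF sum[OF F] t]) (rule bessel_inequality[OF F(1,2)])
  let ?Q = "\<lambda>F. orthonormal F \<and> finite F \<and> F \<subseteq> range G"
  have "card F \<le> nat \<lceil>t\<rceil>" if "?Q F" for F
    using card_le[of F] that by linarith
  moreover have "?Q {}" by (simp add: orthonormal_def)
  ultimately obtain F where F: "?Q F" and max: "\<And>F'. ?Q F' \<Longrightarrow> card F' \<le> card F"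
    using ex_has_greatest_nat[of ?Q "{}" card "Suc (nat \<lceil>t\<rceil>)"] by (force simp: less_Suc_eq_le)
  have on: "orthonormal F" "finite F" and FG: "F \<subseteq> range G" using F by auto
  \<comment> \<open>otherwise the normalised residual could be added to \<open>F\<close>\<close>
  have exp: "x = partial_expansion F x" if x: "x \<in> range G" for x
  proof (rule ccontr)
    assume ne: "x \<noteq> partial_expansion F x"
    define r where "r = x - partial_expansion F x"
    define u where "u = (1 / complex_of_real (norm r)) *\<^sub>C r"
    have "r \<noteq> 0" using ne by (simp add: r_def)
    then have "norm u = 1" by (simp add: u_def norm_scaleC norm_divide)
    have uf: "cinner u f = 0" if "f \<in> F" for f
      using residual_orthogonal[OF on complex_vector.span_base[OF that], of x]
      by (simp add: u_def r_def cinner_scaleC_left)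
    then have fu: "cinner f u = 0" if "f \<in> F" for f
      using that cinner_commute[of f u] by simp
    have "u \<notin> F" using uf[of u] \<open>norm u = 1\<close> by (auto simp: cinner_self)
    have Gf: "G f = f" if "f \<in> F" for f using FG GG that by auto
    have "G (partial_expansion F x) = partial_expansion F x"
    proof (rule cinner_ext)
      fix z
      have "cinner f (G z) = cinner f z" if "f \<in> F" for f
        using Gs[of f z] Gf[OF that] by simp
      then show "cinner (G (partial_expansion F x)) z = cinner (partial_expansion F x) z"
        by (simp add: Gs partial_expansion_def cinner_sum_left cinner_scaleC_left)
    qed
    then have "G u = u" using x GG by (auto simp: u_def r_def Gsc Gd)
    then have "u \<in> range G" by (metis rangeI)
    then have "?Q (insert u F)"
      using F uf fu \<open>norm u = 1\<close> \<open>u \<notin> F\<close> by (auto simp: orthonormal_def cinner_self)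
    from max[OF this] show False using \<open>u \<notin> F\<close> on by simp
  qed
  have sub: "range G \<subseteq> cspan F"
    using exp partial_expansion_span by (metis subsetI)
  then show "cfinite_dim (range G)" using on unfolding cfinite_dim_def by blast
  have "cdim (range G) = card F"
    using sub FG orthonormal_independent[OF on] by (intro complex_vector.dim_unique) auto
  moreover have "(\<Sum>f\<in>F. (cmod (cinner (G b) f))\<^sup>2) = (norm (G b))\<^sup>2" for b
    using norm_residual[OF on, of "G b"] exp[of "G b"] by simp
  then have "((\<lambda>b. (norm (G b))\<^sup>2) has_sum real (card F)) B"
    using sum[OF on FG] by simp
  ultimately show "t = real (cdim (range G))"
    using t has_sum_unique by metis
qed

section \<open>Powers of a selfadjoint contraction\<close>

lemma bounded_clinear_funpow: "bounded_clinear T \<Longrightarrow> bounded_clinear (T ^^ n)"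
  by (induction n)
     (auto simp: bounded_clinear_def o_def id_def intro: bounded_linear_ident bounded_linear_compose)

locale selfadjoint_contraction =
  fixes C :: "'a::chilbert_space \<Rightarrow> 'a"
  assumes bounded: "bounded_clinear C"
    and selfadjoint: "cinner (C x) y = cinner x (C y)"
    and contraction: "norm (C x) \<le> norm x"
begin

lemma bounded_linear_pow: "bounded_linear (C ^^ n)"
  using bounded_clinear_funpow[OF bounded] by (simp add: bounded_clinear_def)

lemma pow_diff: "(C ^^ n) (x - y) = (C ^^ n) x - (C ^^ n) y"
  by (rule linear_diff[OF bounded_linear.linear[OF bounded_linear_pow]])

lemma cinner_pow: "cinner ((C ^^ n) x) y = cinner x ((C ^^ n) y)"
  by (induction n arbitrary: y) (simp_all add: selfadjoint funpow_swap1[symmetric])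

lemma norm_pow_antimono: "m \<le> n \<Longrightarrow> norm ((C ^^ n) x) \<le> norm ((C ^^ m) x)"
  by (induction n rule: dec_induct) (auto intro: order_trans[OF contraction])

lemma inner_pow_pow:
  assumes "m + n = 2 * k"
  shows "inner ((C ^^ m) x) ((C ^^ n) x) = (norm ((C ^^ k) x))\<^sup>2"
proof -
  have "cinner ((C ^^ m) x) ((C ^^ n) x) = cinner x ((C ^^ (m + n)) x)"
    by (simp add: cinner_pow funpow_add)
  also have "\<dots> = cinner ((C ^^ k) x) ((C ^^ k) x)"
    by (simp add: assms cinner_pow mult_2 funpow_add)
  finally show ?thesis
    by (metis Re_cinner power2_norm_eq_inner)
qed

text \<open>
  The numbers \<open>\<parallel>C\<^sup>n x\<parallel>\<^sup>2\<close> decrease, hence converge, and they determine the distances between the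
  vectors \<open>C\<^bsup>2n\<^esup> x\<close> because \<open>C\<close> is selfadjoint.
\<close>

lemma even_pow_convergent: "convergent (\<lambda>n. (C ^^ (2 * n)) x)"
proof -
  define r where "r n = (norm ((C ^^ n) x))\<^sup>2" for n
  have dist: "(norm ((C ^^ (2 * m)) x - (C ^^ (2 * n)) x))\<^sup>2 = r (2 * m) + r (2 * n) - 2 * r (m + n)"
    for m n
    using inner_pow_pow[of "2 * m" "2 * n" "m + n" x]
    by (simp add: r_def power2_norm_eq_inner inner_diff_left inner_diff_right inner_commute)
  have "decseq r"
    unfolding r_def by (intro antimonoI power_mono norm_pow_antimono) auto
  then obtain l where l: "r \<longlonglongrightarrow> l" and ge: "\<And>n. l \<le> r n"
    using decseq_convergent[of r 0] by (auto simp: r_def)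
  have "Cauchy (\<lambda>n. (C ^^ (2 * n)) x)"
  proof (rule CauchyI)
    fix \<epsilon> :: real assume "\<epsilon> > 0"
    then obtain N where N: "\<And>n. n \<ge> N \<Longrightarrow> r n < l + \<epsilon>\<^sup>2 / 2"
      using order_tendstoD(2)[OF l, of "l + \<epsilon>\<^sup>2 / 2"] unfolding eventually_sequentially by auto
    show "\<exists>M. \<forall>m\<ge>M. \<forall>n\<ge>M. norm ((C ^^ (2 * m)) x - (C ^^ (2 * n)) x) < \<epsilon>"
    proof (intro exI[of _ N] allI impI)
      fix m n assume "m \<ge> N" "n \<ge> N"
      then have "(norm ((C ^^ (2 * m)) x - (C ^^ (2 * n)) x))\<^sup>2 < \<epsilon>\<^sup>2"
        unfolding dist using N[of "2 * m"] N[of "2 * n"] ge[of "m + n"] by linarith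
      then show "norm ((C ^^ (2 * m)) x - (C ^^ (2 * n)) x) < \<epsilon>"
        using \<open>\<epsilon> > 0\<close> by (simp add: power2_less_imp_less)
    qed
  qed
  then show ?thesis by (rule Cauchy_convergent)
qed

text \<open>
  Orthogonal projection onto the vectors fixed by \<open>C\<^sup>2\<close>. Even powers are needed since \<open>C\<close> may have
  the eigenvalue \<open>-1\<close>.
\<close>

definition fix_proj :: "'a \<Rightarrow> 'a" where
  "fix_proj x = lim (\<lambda>n. (C ^^ (2 * n)) x)"

lemma fix_proj_tendsto: "(\<lambda>n. (C ^^ (2 * n)) x) \<longlonglongrightarrow> fix_proj x"
  using even_pow_convergent by (simp add: fix_proj_def convergent_LIMSEQ_iff)

lemma fix_proj_commute:
  assumes "bounded_linear T" and "\<And>x. T (C (C x)) = C (C (T x))"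
  shows "T (fix_proj x) = fix_proj (T x)"
proof -
  have "T ((C ^^ (2 * n)) x) = (C ^^ (2 * n)) (T x)" for n
    by (induction n) (simp_all add: assms(2))
  then have "(\<lambda>n. (C ^^ (2 * n)) (T x)) \<longlonglongrightarrow> T (fix_proj x)"
    using bounded_linear.tendsto[OF assms(1) fix_proj_tendsto[of x]] by simp
  then show ?thesis using fix_proj_tendsto LIMSEQ_unique by blast
qed

lemma C_fix_proj: "C (fix_proj x) = fix_proj (C x)"
  using bounded by (intro fix_proj_commute) (auto simp: bounded_clinear_def)

lemma fix_proj_fixed: "C (C (fix_proj x)) = fix_proj x"
proof -
  have "(\<lambda>n. (C ^^ 2) ((C ^^ (2 * n)) x)) \<longlonglongrightarrow> (C ^^ 2) (fix_proj x)"
    by (rule bounded_linear.tendsto[OF bounded_linear_pow fix_proj_tendsto])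
  moreover have "(C ^^ 2) ((C ^^ (2 * n)) x) = (C ^^ (2 * Suc n)) x" for n
    by (simp add: numeral_2_eq_2)
  ultimately have "(\<lambda>n. (C ^^ (2 * Suc n)) x) \<longlonglongrightarrow> C (C (fix_proj x))"
    by (simp add: numeral_2_eq_2)
  with LIMSEQ_Suc[OF fix_proj_tendsto] show ?thesis using LIMSEQ_unique by blast
qed

lemma fix_proj_eq:
  assumes "C (C x) = x" shows "fix_proj x = x"
proof -
  have "(C ^^ (2 * n)) x = x" for n by (induction n) (simp_all add: assms)
  then show ?thesis using LIMSEQ_unique[OF fix_proj_tendsto[of x]] by simp
qed

lemma fix_proj_idem: "fix_proj (fix_proj x) = fix_proj x"
  by (rule fix_proj_eq[OF fix_proj_fixed])

lemma fix_proj_cinner: "cinner (fix_proj x) y = cinner x (fix_proj y)"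
proof -
  have bl: "bounded_linear (\<lambda>u. cinner u z)" for z :: 'a
  proof (rule bounded_linear_intro[where K = "norm z"])
    show "cinner (r *\<^sub>R u) z = r *\<^sub>R cinner u z" for r u
      by (metis cinner_scaleC_left scaleC_of_real scaleR_conv_of_real)
  qed (auto simp: cinner_add_left cinner_bound)
  have 1: "(\<lambda>n. cinner ((C ^^ (2 * n)) x) y) \<longlonglongrightarrow> cinner (fix_proj x) y"
    by (rule bounded_linear.tendsto[OF bl fix_proj_tendsto])
  have "(\<lambda>n. cnj (cinner ((C ^^ (2 * n)) y) x)) \<longlonglongrightarrow> cnj (cinner (fix_proj y) x)"
    by (intro tendsto_cnj bounded_linear.tendsto[OF bl fix_proj_tendsto])
  moreover have "cnj (cinner ((C ^^ (2 * n)) y) x) = cinner ((C ^^ (2 * n)) x) y" for n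
    using cinner_commute[of "(C ^^ (2 * n)) x" y] by (simp add: cinner_pow)
  moreover have "cnj (cinner (fix_proj y) x) = cinner x (fix_proj y)"
    by (rule cinner_commute[symmetric])
  ultimately show ?thesis using LIMSEQ_unique[OF 1] by simp
qed

lemma fix_proj_add: "fix_proj (x + y) = fix_proj x + fix_proj y"
  by (rule cinner_ext) (simp add: fix_proj_cinner cinner_add_left)

lemma fix_proj_scaleC: "fix_proj (c *\<^sub>C x) = c *\<^sub>C fix_proj x"
  by (rule cinner_ext) (simp add: fix_proj_cinner cinner_scaleC_left)

lemma norm_pow_tendsto: "(\<lambda>n. (norm ((C ^^ n) x))\<^sup>2) \<longlonglongrightarrow> (norm (fix_proj x))\<^sup>2"
proof -
  have "(\<lambda>n. inner ((C ^^ (2 * n)) x) x) \<longlonglongrightarrow> inner (fix_proj x) x"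
    by (intro tendsto_inner tendsto_const fix_proj_tendsto)
  moreover have "inner ((C ^^ (2 * n)) x) x = (norm ((C ^^ n) x))\<^sup>2" for n
    using inner_pow_pow[of "2 * n" 0 n x] by simp
  moreover have "inner (fix_proj x) x = (norm (fix_proj x))\<^sup>2"
    by (metis Re_cinner fix_proj_cinner fix_proj_idem power2_norm_eq_inner)
  ultimately show ?thesis by simp
qed

lemma norm_fix_proj_le: "norm (fix_proj x) \<le> norm ((C ^^ n) x)"
proof -
  have "(norm (fix_proj x))\<^sup>2 \<le> (norm ((C ^^ n) x))\<^sup>2"
    by (rule LIMSEQ_le_const2[OF norm_pow_tendsto])
       (use norm_pow_antimono in \<open>auto intro!: power_mono exI[of _ n]\<close>)
  then show ?thesis by (simp add: power2_le_iff_abs_le)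
qed

lemma fix_proj_projection: "projection fix_proj"
proof -
  have "bounded_linear fix_proj"
  proof (rule bounded_linear_intro[where K = 1])
    show "fix_proj (r *\<^sub>R x) = r *\<^sub>R fix_proj x" for r x
      by (metis fix_proj_scaleC scaleC_of_real)
    show "norm (fix_proj x) \<le> norm x * 1" for x
      using norm_fix_proj_le[of x 0] by simp
  qed (rule fix_proj_add)
  then show ?thesis
    by (simp add: projection_def bounded_clinear_def fix_proj_scaleC fix_proj_idem fix_proj_cinner)
qed

lemma fix_proj_diff: "fix_proj (x - y) = fix_proj x - fix_proj y"
  by (rule cinner_ext) (simp add: fix_proj_cinner cinner_diff_left)

lemma norm_diff_fix_proj_le: "norm (x - fix_proj x) \<le> norm x"
proof -
  have "cinner (x - fix_proj x) (fix_proj x) = 0"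
    by (simp add: cinner_diff_left fix_proj_cinner fix_proj_idem)
  from norm_add_orthogonal[OF this] have "(norm (x - fix_proj x))\<^sup>2 \<le> (norm x)\<^sup>2" by simp
  then show ?thesis by (simp add: power2_le_iff_abs_le)
qed

lemma pow_fix_proj: "(C ^^ n) (fix_proj x) = fix_proj ((C ^^ n) x)"
  by (induction n) (simp_all add: C_fix_proj)

text \<open>
  The sequence \<open>\<parallel>C\<^sup>n x\<parallel>\<^sup>2\<close> is convex, because its second difference is the squared norm of
  \<open>C\<^sup>k x - C\<^bsup>k+2\<^esup> x\<close>, so its first decrement is its largest.
\<close>

lemma defect_accumulation:
  "(norm x)\<^sup>2 - (norm ((C ^^ n) x))\<^sup>2 \<le> n * ((norm x)\<^sup>2 - (norm (C x))\<^sup>2)"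
proof -
  define r where "r n = (norm ((C ^^ n) x))\<^sup>2" for n
  have convex: "r (Suc k) - r (Suc (Suc k)) \<le> r k - r (Suc k)" for k
  proof -
    have "0 \<le> (norm ((C ^^ k) x - (C ^^ (k + 2)) x))\<^sup>2" by simp
    also have "\<dots> = r k + r (k + 2) - 2 * r (k + 1)"
      using inner_pow_pow[of k "k + 2" "k + 1" x]
      by (simp add: r_def power2_norm_eq_inner inner_diff_left inner_diff_right inner_commute)
    finally show ?thesis by (simp add: numeral_2_eq_2)
  qed
  have step: "r k - r (Suc k) \<le> r 0 - r 1" for k
  proof (induction k)
    case (Suc k)
    then show ?case using convex[of k] by linarith
  qed simp
  have "r 0 - r n \<le> n * (r 0 - r 1)"
  proof (induction n)
    case (Suc n)
    then show ?case using step[of n] by (simp add: algebra_simps)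
  qed simp
  then show ?thesis by (simp add: r_def)
qed

text \<open>
  The operators \<open>C\<^sup>n (1 - fix_proj)\<close> tend to 0 in Hilbert--Schmidt norm, by dominated convergence. So
  some \<open>n\<close> has \<open>\<parallel>C\<^sup>n x\<parallel>\<^sup>2 \<le> \<parallel>x\<parallel>\<^sup>2 / 2\<close> for all \<open>x\<close> orthogonal to the fixed space, and the loss
  that has accumulated after \<open>n\<close> steps is at most \<open>n\<close> times that of the first step.
\<close>

lemma spectral_gap:
  assumes B: "orthonormal_basis B" and sum: "(\<lambda>b. (norm (C b))\<^sup>2) summable_on B"
  obtains c where "c > 0"
    and "\<And>x. fix_proj x = 0 \<Longrightarrow> c * (norm x)\<^sup>2 \<le> (norm x)\<^sup>2 - (norm (C x))\<^sup>2"
proof -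
  define R where "R n x = (C ^^ Suc n) (x - fix_proj x)" for n x
  define s where "s n = infsum (\<lambda>b. (norm (R n b))\<^sup>2) B" for n
  have R_le: "norm (R n x) \<le> norm (C x)" for n x
  proof -
    have "norm (R n x) \<le> norm ((C ^^ 1) (x - fix_proj x))"
      unfolding R_def by (rule norm_pow_antimono) simp
    also have "\<dots> = norm (C x - fix_proj (C x))"
      using pow_diff[of 1] by (simp add: C_fix_proj)
    also have "\<dots> \<le> norm (C x)" by (rule norm_diff_fix_proj_le)
    finally show ?thesis .
  qed
  have hs: "((\<lambda>b. (norm (R n b))\<^sup>2) has_sum s n) B" for n
    unfolding s_def
    by (intro has_sum_infsum summable_on_comparison_test[OF sum] power_mono R_le) auto
  have "s \<longlonglongrightarrow> infsum (\<lambda>b. 0) B"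
  proof (rule dominated_convergence_has_sum(2)[OF hs _ sum])
    show "\<bar>(norm (R n b))\<^sup>2\<bar> \<le> (norm (C b))\<^sup>2" for n b
      using R_le by (simp add: power_mono)
    show "(\<lambda>n. (norm (R n b))\<^sup>2) \<longlonglongrightarrow> 0" for b
      using LIMSEQ_Suc[OF norm_pow_tendsto[of "b - fix_proj b"]]
      by (simp add: R_def fix_proj_diff fix_proj_idem)
  qed
  then have "\<exists>n. s n < 1 / 2"
    using order_tendstoD(2)[of s 0 sequentially "1/2"] by (auto dest: eventually_happens)
  then obtain n where n: "s n < 1 / 2" by blast
  have adj: "cinner (R n x) y = cinner x (R n y)" for x y
  proof -
    have "cinner (R n x) y = cinner x ((C ^^ Suc n) y - fix_proj ((C ^^ Suc n) y))"
      unfolding R_def cinner_pow by (simp only: cinner_diff_left cinner_diff_right fix_proj_cinner)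
    then show ?thesis unfolding R_def pow_diff pow_fix_proj .
  qed
  show ?thesis
  proof (rule that[of "1 / (2 * real (Suc n))"])
    fix x assume "fix_proj x = 0"
    then have "(norm ((C ^^ Suc n) x))\<^sup>2 \<le> s n * (norm x)\<^sup>2"
      using norm_le_hilbert_schmidt_norm[OF B adj hs, of x] by (simp add: R_def)
    also have "\<dots> \<le> 1 / 2 * (norm x)\<^sup>2" using n by (intro mult_right_mono) auto
    finally have "1 / 2 * (norm x)\<^sup>2 \<le> real (Suc n) * ((norm x)\<^sup>2 - (norm (C x))\<^sup>2)"
      using defect_accumulation[of x "Suc n"] by linarith
    then show "1 / (2 * real (Suc n)) * (norm x)\<^sup>2 \<le> (norm x)\<^sup>2 - (norm (C x))\<^sup>2"
      by (simp add: field_simps)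
  qed simp
qed

end

section \<open>Pairs of projections\<close>

locale two_projections =
  fixes p q :: "'a::chilbert_space \<Rightarrow> 'a"
  assumes proj_p: "projection p" and proj_q: "projection q"
begin

lemma bounded_linear_p: "bounded_linear p" and bounded_linear_q: "bounded_linear q"
  using proj_p proj_q by (auto simp: projection_def bounded_clinear_def)

lemma idem: "p (p x) = p x" "q (q x) = q x"
  using proj_p proj_q by (auto simp: projection_def)

lemma p_cinner: "cinner (p x) y = cinner x (p y)"
  and q_cinner: "cinner (q x) y = cinner x (q y)"
  using proj_p proj_q by (auto simp: projection_def)

lemma p_inner: "inner (p x) y = inner x (p y)"
  by (simp flip: Re_cinner add: p_cinner)

lemma scaleC: "p (c *\<^sub>C x) = c *\<^sub>C p x" "q (c *\<^sub>C x) = c *\<^sub>C q x"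
  using proj_p proj_q by (auto simp: projection_def bounded_clinear_def)

lemmas additive =
  linear_add[OF bounded_linear.linear[OF bounded_linear_p]]
  linear_add[OF bounded_linear.linear[OF bounded_linear_q]]
  linear_diff[OF bounded_linear.linear[OF bounded_linear_p]]
  linear_diff[OF bounded_linear.linear[OF bounded_linear_q]]
  linear_neg[OF bounded_linear.linear[OF bounded_linear_p]]
  linear_neg[OF bounded_linear.linear[OF bounded_linear_q]]
  linear_0[OF bounded_linear.linear[OF bounded_linear_p]]
  linear_0[OF bounded_linear.linear[OF bounded_linear_q]]

definition C :: "'a \<Rightarrow> 'a" where "C x = p x - q x"

definition S :: "'a \<Rightarrow> 'a" where "S x = x - p x - q x"

lemmas operator_algebra = C_def S_def additive idem

lemma square_sum: "S (S x) = x - C (C x)"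
  by (simp add: operator_algebra algebra_simps)

lemma anticommute: "C (S x) = - S (C x)"
  by (simp add: operator_algebra algebra_simps)

text \<open>
  Composed, these two relations make \<open>S C\<close> carry the range of \<open>1 - q\<close> into the range of \<open>q\<close>.
\<close>

lemma C_intertwines: "C (x - q x) = p (C x)"
  by (simp add: operator_algebra algebra_simps)

lemma S_intertwines: "S (p x) = q (S x)"
  by (simp add: operator_algebra algebra_simps)

lemma CC_commute: "p (C (C x)) = C (C (p x))" "q (C (C x)) = C (C (q x))"
  by (simp_all add: operator_algebra algebra_simps)

lemma C_cinner: "cinner (C x) y = cinner x (C y)"
  and S_cinner: "cinner (S x) y = cinner x (S y)"
  by (simp_all add: C_def S_def cinner_diff_left cinner_diff_right p_cinner q_cinner)

lemma norm_C_S: "(norm (C x))\<^sup>2 + (norm (S x))\<^sup>2 = (norm x)\<^sup>2"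
proof -
  have "cinner (C x) (C x) + cinner (S x) (S x) = cinner x (C (C x) + S (S x))"
    by (simp add: C_cinner S_cinner cinner_add_right)
  then have "cinner (C x) (C x) + cinner (S x) (S x) = cinner x x"
    by (simp add: square_sum)
  then show ?thesis
    unfolding cinner_self of_real_add[symmetric] of_real_eq_iff .
qed

lemma norm_S_le: "norm (S x) \<le> norm x"
proof (rule power2_le_imp_le)
  show "(norm (S x))\<^sup>2 \<le> (norm x)\<^sup>2"
    using norm_C_S[of x] zero_le_power2[of "norm (C x)"] by linarith
qed simp

lemma bounded_clinear_C: "bounded_clinear C"
  unfolding bounded_clinear_def C_def
  by (auto intro: bounded_linear_sub bounded_linear_p bounded_linear_q
      simp: scaleC complex_vector.scale_right_diff_distrib)

sublocale selfadjoint_contraction C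
proof
  show "norm (C x) \<le> norm x" for x
  proof (rule power2_le_imp_le)
    show "(norm (C x))\<^sup>2 \<le> (norm x)\<^sup>2"
      using norm_C_S[of x] zero_le_power2[of "norm (S x)"] by linarith
  qed simp
qed (rule bounded_clinear_C C_cinner)+

abbreviation E where "E \<equiv> fix_proj"

lemma E_commute: "p (E x) = E (p x)" "q (E x) = E (q x)"
  by (intro fix_proj_commute bounded_linear_p bounded_linear_q CC_commute)+

text \<open>
  Since \<open>C\<^sup>2\<close> is the identity on the range of \<open>E\<close>, \<open>C\<close> is isometric there, which leaves no room for
  \<open>S\<close> in \<open>\<parallel>C z\<parallel>\<^sup>2 + \<parallel>S z\<parallel>\<^sup>2 = \<parallel>z\<parallel>\<^sup>2\<close>.
\<close>

lemma S_E: "S (E x) = 0"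
proof -
  have "norm (E x) \<le> norm (C (E x))"
    using contraction[of "C (E x)"] by (simp add: fix_proj_fixed)
  then have "norm (C (E x)) = norm (E x)"
    using contraction[of "E x"] by simp
  then show ?thesis using norm_C_S[of "E x"] by simp
qed

lemma p_E: "p (E x) = E x - q (E x)"
  using S_E[of x] by (simp add: S_def algebra_simps)

text \<open>
  A vector of \<open>ran p \<inter> ker q\<close> is fixed by \<open>C\<close>. Conversely \<open>p = 1 - q\<close> on the range of \<open>E\<close>.
\<close>

lemma kernel_eq: "{x \<in> range p. q x = 0} = range (\<lambda>x. E (x - q x))"
proof (intro equalityI subsetI)
  fix x assume "x \<in> {x \<in> range p. q x = 0}"
  then have "p x = x" "q x = 0" by (auto simp: idem)
  then have "C (C x) = x" by (simp add: C_def)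
  then have "x = E (x - q x)" using \<open>q x = 0\<close> by (simp add: fix_proj_eq)
  then show "x \<in> range (\<lambda>x. E (x - q x))" by (rule range_eqI)
next
  fix z assume "z \<in> range (\<lambda>x. E (x - q x))"
  then obtain x where z: "z = E (x - q x)" by blast
  have "q z = 0" by (simp add: z E_commute(2) additive idem fix_proj_diff)
  moreover from this have "p z = z" using p_E[of "x - q x"] by (simp add: z)
  ultimately show "z \<in> {x \<in> range p. q x = 0}" by (auto intro: range_eqI[of _ _ z])
qed

text \<open>
  A vector of \<open>ker p \<inter> ran q\<close> is negated by \<open>C\<close>, hence fixed by \<open>C\<^sup>2\<close>.
\<close>

lemma cokernel_eq: "{y \<in> range q. p y = 0} = range (\<lambda>x. E (q x))"
proof (intro equalityI subsetI)
  fix x assume "x \<in> {x \<in> range q. p x = 0}"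
  then have "q x = x" "p x = 0" by (auto simp: idem)
  then have "C (C x) = x" by (simp add: C_def additive)
  then have "x = E (q x)" using \<open>q x = x\<close> by (simp add: fix_proj_eq)
  then show "x \<in> range (\<lambda>x. E (q x))" by (rule range_eqI)
next
  fix z assume "z \<in> range (\<lambda>x. E (q x))"
  then obtain x where z: "z = E (q x)" by blast
  have "q z = z" by (simp add: z E_commute(2) idem)
  moreover from this have "p z = 0" using p_E[of "q x"] by (simp add: z)
  ultimately show "z \<in> {y \<in> range q. p y = 0}" by (auto intro: range_eqI[of _ _ z])
qed

lemma projection_E_q: "projection (\<lambda>x. E (q x))"
  and projection_E_1q: "projection (\<lambda>x. E (x - q x))"
proof -
  have bE: "bounded_linear E" using fix_proj_projection by (simp add: projection_def bounded_clinear_def)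
  show "projection (\<lambda>x. E (q x))"
    unfolding projection_def bounded_clinear_def
    by (auto intro: bounded_linear_compose[OF bE] bounded_linear_q
        simp: E_commute idem fix_proj_idem scaleC fix_proj_scaleC fix_proj_cinner q_cinner)
  show "projection (\<lambda>x. E (x - q x))"
    unfolding projection_def bounded_clinear_def
    by (auto intro!: bounded_linear_compose[OF bE] bounded_linear_sub bounded_linear_q
        simp: E_commute idem additive fix_proj_idem fix_proj_diff scaleC fix_proj_scaleC fix_proj_cinner q_cinner
          cinner_diff_left cinner_diff_right complex_vector.scale_right_diff_distrib)
qed

lemma adjoint_on_eq:
  assumes "y \<in> range q" shows "adjoint_on (range p) q y = p y"
  unfolding adjoint_on_def
proof (rule the_equality)
  have qy: "q y = y" using assms idem by auto
  show "p y \<in> range p \<and> (\<forall>x\<in>range p. cinner (q x) y = cinner x (p y))"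
    by (auto simp: q_cinner qy idem simp flip: p_cinner)
  fix z assume z: "z \<in> range p \<and> (\<forall>x\<in>range p. cinner (q x) y = cinner x z)"
  then have pz: "p z = z" using idem by auto
  show "z = p y"
  proof (rule cinner_ext)
    fix x
    have "cinner (p x) z = cinner (p x) y" using z by (metis q_cinner qy rangeI)
    then show "cinner z x = cinner (p y) x"
      by (metis p_cinner pz cinner_commute)
  qed
qed

lemma index_eq:
  "ess_codim p q = int (cdim (range (\<lambda>x. E (x - q x)))) - int (cdim (range (\<lambda>x. E (q x))))"
proof -
  have "kernel_on (range q) (adjoint_on (range p) q) = {y \<in> range q. p y = 0}"
    unfolding kernel_on_def using adjoint_on_eq by auto
  then show ?thesis
    unfolding ess_codim_def index_on_def kernel_on_def[of "range p"] kernel_eq by (simp add: cokernel_eq)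
qed

lemma q_E_p: "q (E (p x)) = 0"
  using p_E[of "p x"] E_commute(1)[of "p x"] by (simp add: idem)

section \<open>The trace of the difference and the index\<close>

text \<open>
  The operator \<open>S C\<^bsup>2k+1\<^esup>\<close>. An odd power of \<open>C\<close> makes it skew-adjoint, because \<open>S\<close> and \<open>C\<close>
  anticommute, and makes it exchange \<open>1 - q\<close> and \<open>q\<close>.
\<close>

definition odd_op :: "nat \<Rightarrow> 'a \<Rightarrow> 'a" where
  "odd_op k x = S ((C ^^ (2 * k)) (C x))"

lemma even_pow_commute: "p ((C ^^ (2 * k)) x) = (C ^^ (2 * k)) (p x)"
  by (induction k) (simp_all add: CC_commute)

lemma odd_op_intertwines: "odd_op k (x - q x) = q (odd_op k x)"
  unfolding odd_op_def C_intertwines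
  by (simp flip: even_pow_commute add: S_intertwines)

lemma S_pow: "(C ^^ n) (S x) = (-1) ^ n *\<^sub>R S ((C ^^ n) x)"
proof (induction n)
  case (Suc n)
  have "C (r *\<^sub>R y) = r *\<^sub>R C y" for r y
    using bounded by (simp add: bounded_clinear_def linear_cmul bounded_linear.linear)
  with Suc show ?case by (simp add: anticommute)
qed simp

lemma odd_op_skew: "cinner (odd_op k x) y = - cinner x (odd_op k y)"
proof -
  have "cinner (odd_op k x) y = cinner x ((C ^^ Suc (2 * k)) (S y))"
    unfolding odd_op_def S_cinner by (simp add: cinner_pow C_cinner)
  also have "\<dots> = - cinner x (odd_op k y)"
    unfolding S_pow by (simp add: odd_op_def cinner_minus_right funpow_swap1)
  finally show ?thesis .
qed

lemma norm_odd_op_le: "norm (odd_op k x) \<le> norm (C x)"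
proof -
  have "norm (odd_op k x) \<le> norm ((C ^^ (2 * k)) (C x))"
    unfolding odd_op_def by (rule norm_S_le)
  also have "\<dots> \<le> norm ((C ^^ 0) (C x))" by (rule norm_pow_antimono) simp
  finally show ?thesis by simp
qed

text \<open>
  Selfadjointness and \<open>S\<^sup>2 = 1 - C\<^sup>2\<close> turn the left-hand side into
  \<open>\<langle>(1 - C\<^sup>2) C x, C\<^bsup>2k+1\<^esup> x\<rangle>\<close>.
\<close>

lemma inner_odd_op:
  "inner (odd_op 0 x) (odd_op k x) = (norm ((C ^^ Suc k) x))\<^sup>2 - (norm ((C ^^ Suc (Suc k)) x))\<^sup>2"
proof -
  let ?m = "2 * k + 1"
  have "inner (odd_op 0 x) (odd_op k x) = inner (S (S (C x))) ((C ^^ ?m) x)"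
    by (simp flip: Re_cinner add: odd_op_def S_cinner funpow_swap1)
  also have "\<dots> = inner ((C ^^ 1) x) ((C ^^ ?m) x) - inner ((C ^^ 3) x) ((C ^^ ?m) x)"
    by (simp add: square_sum inner_diff_left numeral_3_eq_3)
  also have "\<dots> = (norm ((C ^^ (k + 1)) x))\<^sup>2 - (norm ((C ^^ (k + 2)) x))\<^sup>2"
    using inner_pow_pow[of 1 ?m "k + 1" x] inner_pow_pow[of 3 ?m "k + 2" x] by simp
  finally show ?thesis by simp
qed

text \<open>
  The adjoint of \<open>X (1 - q)\<close> is \<open>-(1 - q) X = - X q\<close>, so \<open>X (1 - q)\<close> and \<open>X q\<close> have the same
  Hilbert--Schmidt norm.
\<close>

lemma skew_intertwiner_trace:
  assumes B: "orthonormal_basis B"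
    and inter: "\<And>x. X (x - q x) = q (X x)"
    and skew: "\<And>x y. cinner (X x) y = - cinner x (X y)"
    and sum: "(\<lambda>b. (norm (X (b - q b)))\<^sup>2) summable_on B"
  shows "((\<lambda>b. (norm (X (b - q b)))\<^sup>2 - (norm (X (q b)))\<^sup>2) has_sum 0) B"
proof -
  have X_q: "X (q x) = X x - q (X x)" for x
  proof (rule cinner_ext)
    fix z
    have "cinner (X (q x)) z = - cinner x (q (X z))" by (simp add: skew q_cinner)
    also have "\<dots> = - cinner x (X (z - q z))" by (simp add: inter)
    also have "\<dots> = cinner (X x) (z - q z)" by (simp add: skew)
    finally show "cinner (X (q x)) z = cinner (X x - q (X x)) z"
      by (simp add: cinner_diff_left cinner_diff_right q_cinner)
  qed
  obtain s where s: "((\<lambda>b. (norm (X (b - q b)))\<^sup>2) has_sum s) B"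
    using sum by (auto simp: summable_on_def)
  have "cinner (X (x - q x)) y = cinner x (- X (q y))" for x y
    by (simp add: skew X_q cinner_diff_left cinner_minus_right cinner_diff_right q_cinner)
  from hilbert_schmidt_norm_adjoint[OF B this s]
  have "((\<lambda>b. (norm (X (q b)))\<^sup>2) has_sum s) B" by simp
  from has_sum_diff[OF s this] show ?thesis by simp
qed

text \<open>
  If \<open>q b\<close> is \<open>0\<close> or \<open>b\<close>, this is \<open>\<langle>(1 - 2q) C\<^bsup>2n\<^esup> b, b\<rangle>\<close>, so the sum over a basis that
  diagonalises \<open>q\<close> is \<open>Tr ((1 - 2q) C\<^bsup>2n\<^esup>)\<close>.
\<close>

definition weight :: "nat \<Rightarrow> 'a \<Rightarrow> real" where
  "weight n b = (norm ((C ^^ n) (b - q b)))\<^sup>2 - (norm ((C ^^ n) (q b)))\<^sup>2"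

text \<open>
  The difference of the weights is \<open>\<langle>U u, V u\<rangle> - \<langle>U v, V v\<rangle>\<close> with \<open>U = odd_op 0\<close>,
  \<open>V = odd_op k\<close>, \<open>u = (1 - q) b\<close> and \<open>v = q b\<close>. Both \<open>U + V\<close> and \<open>U - V\<close> are skew-adjoint
  intertwiners, so the sum vanishes by polarisation. The exponents are split as \<open>1 + (2k + 1)\<close>, not
  evenly, because only odd powers of \<open>C\<close> give intertwiners.
\<close>

lemma weight_telescope:
  assumes B: "orthonormal_basis B" and diag: "\<And>b. b \<in> B \<Longrightarrow> q b = b \<or> q b = 0"
    and sum: "(\<lambda>b. (norm (C b))\<^sup>2) summable_on B"
  shows "((\<lambda>b. weight (Suc k) b - weight (Suc (Suc k)) b) has_sum 0) B"
proof -
  have C0: "C 0 = 0" by (simp add: operator_algebra)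
  define D where "D r b = (norm (odd_op 0 (b - q b) + r *\<^sub>R odd_op k (b - q b)))\<^sup>2
      - (norm (odd_op 0 (q b) + r *\<^sub>R odd_op k (q b)))\<^sup>2" for r b
  have zero: "(D r has_sum 0) B" if r: "\<bar>r\<bar> = 1" for r
    unfolding D_def
  proof (rule skew_intertwiner_trace[OF B])
    let ?X = "\<lambda>x. odd_op 0 x + r *\<^sub>R odd_op k x"
    show "?X (x - q x) = q (?X x)" for x
      by (simp add: odd_op_intertwines additive linear_cmul[OF bounded_linear.linear[OF bounded_linear_q]])
    show "cinner (?X x) y = - cinner x (?X y)" for x y
      by (simp flip: scaleC_of_real add: cinner_add_left cinner_add_right cinner_scaleC_left
          cinner_scaleC_right odd_op_skew)
    show "(\<lambda>b. (norm (?X (b - q b)))\<^sup>2) summable_on B"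
    proof (rule summable_on_comparison_test)
      show "(\<lambda>b. 4 * (norm (C b))\<^sup>2) summable_on B" by (intro summable_on_cmult_right sum)
      fix b assume "b \<in> B"
      then have "norm (C (b - q b)) \<le> norm (C b)" using diag[of b] by (auto simp: C0)
      then have "norm (?X (b - q b)) \<le> 2 * norm (C b)"
        using norm_triangle_ineq[of "odd_op 0 (b - q b)" "r *\<^sub>R odd_op k (b - q b)"]
          norm_odd_op_le[of 0 "b - q b"] norm_odd_op_le[of k "b - q b"] r by simp
      then have "(norm (?X (b - q b)))\<^sup>2 \<le> (2 * norm (C b))\<^sup>2" by (rule power_mono) simp
      then show "(norm (?X (b - q b)))\<^sup>2 \<le> 4 * (norm (C b))\<^sup>2" by (simp add: power_mult_distrib)
    qed simp
  qed
  have polar: "(norm (u + 1 *\<^sub>R v))\<^sup>2 - (norm (u + (-1) *\<^sub>R v))\<^sup>2 = 4 * inner u v" for u v :: 'a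
    by (simp add: power2_norm_eq_inner inner_add_left inner_add_right inner_diff_left inner_diff_right inner_commute)
  have "1 / 4 * (D 1 b - D (-1) b) = weight (Suc k) b - weight (Suc (Suc k)) b" for b
    using polar[of "odd_op 0 (b - q b)" "odd_op k (b - q b)"] polar[of "odd_op 0 (q b)" "odd_op k (q b)"]
    unfolding D_def inner_odd_op weight_def by argo
  moreover have "((\<lambda>b. 1 / 4 * (D 1 b - D (-1) b)) has_sum 1 / 4 * (0 - 0)) B"
    by (intro has_sum_cmult_right has_sum_diff zero) auto
  ultimately show ?thesis by (simp only: diff_self mult_zero_right)
qed

text \<open>
  From here on \<open>B\<close> diagonalises \<open>q\<close>. This matters because \<open>C\<close> need not be trace class, so that its
  diagonal sum depends on the basis.
\<close>

context
  fixes B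
  assumes B: "orthonormal_basis B" and diag: "\<And>b. b \<in> B \<Longrightarrow> q b = b \<or> q b = 0"
    and sum: "(\<lambda>b. (norm (C b))\<^sup>2) summable_on B"
begin

lemma weight_1: "b \<in> B \<Longrightarrow> weight 1 b = inner (C b) b"
proof -
  assume "b \<in> B"
  then consider "q b = b" | "q b = 0" using diag by blast
  then show ?thesis
  proof cases
    case 1
    have "inner (p b) (p b) = inner (p b) b" by (simp add: p_inner idem)
    with 1 show ?thesis
      by (simp add: weight_def C_def additive power2_norm_eq_inner inner_diff_left inner_diff_right inner_commute)
  next
    case 2
    have "inner (p b) (p b) = inner (p b) b" by (simp add: p_inner idem)
    with 2 show ?thesis
      by (simp add: weight_def C_def additive power2_norm_eq_inner)
  qed
qed

lemma abs_weight:
  assumes "b \<in> B"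
  shows "\<bar>weight (Suc k) b\<bar> \<le> (norm (C b))\<^sup>2"
proof -
  have C0: "(C ^^ n) 0 = 0" for n by (induction n) (simp_all add: operator_algebra)
  have "\<bar>weight (Suc k) b\<bar> = (norm ((C ^^ (Suc k)) b))\<^sup>2"
    unfolding weight_def using diag[OF assms] C0[of "Suc k"] by auto
  then show ?thesis
    using norm_pow_antimono[of 1 "Suc k" b] by (simp add: power_mono)
qed

lemma weight_sum:
  "(weight (Suc k) has_sum infsum (\<lambda>b. inner (C b) b) B) B"
proof (induction k)
  case 0
  have "(\<lambda>b. norm (weight 1 b)) summable_on B"
    by (rule summable_on_comparison_test[OF sum]) (use abs_weight[of _ 0] in auto)
  then have "weight 1 summable_on B" by (rule abs_summable_summable)
  then have "(weight 1 has_sum infsum (weight 1) B) B" by (rule has_sum_infsum)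
  moreover have "infsum (weight 1) B = infsum (\<lambda>b. inner (C b) b) B"
    by (rule infsum_cong[OF weight_1])
  ultimately show ?case by simp
next
  case (Suc k)
  have "u - (u - v) = v" for u v :: real by simp
  then show ?case
    using has_sum_diff[OF Suc weight_telescope[OF B diag sum, of k]] by simp
qed

text \<open>
  The weights sum to the same number for every \<open>n \<ge> 1\<close>, and for \<open>n = 1\<close> this is the diagonal
  sum of \<open>C\<close>. Letting \<open>n\<close> tend to infinity, they converge to the weights of \<open>E\<close>, whose sum is the
  difference of the traces of the projections \<open>E (1 - q)\<close> and \<open>E q\<close>.
\<close>

lemma ess_codim_trace:
  shows kernel_finite_dim: "cfinite_dim (range (\<lambda>x. E (x - q x)))"
    and cokernel_finite_dim: "cfinite_dim (range (\<lambda>x. E (q x)))"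
    and diagonal_sum_eq_ess_codim: "((\<lambda>b. inner (C b) b) has_sum ess_codim p q) B"
proof -
  have z: "E 0 = 0" "C 0 = 0" using fix_proj_diff[of 0 0] by (auto simp: operator_algebra)
  have "norm (E (b - q b)) \<le> norm (C b)" "norm (E (q b)) \<le> norm (C b)" if "b \<in> B" for b
    using diag[OF that] norm_fix_proj_le[of b 1] by (auto simp: z)
  then have "(\<lambda>b. (norm (E (b - q b)))\<^sup>2) summable_on B" "(\<lambda>b. (norm (E (q b)))\<^sup>2) summable_on B"
    by (auto intro!: summable_on_comparison_test[OF sum] power_mono)
  then obtain s t where st: "((\<lambda>b. (norm (E (b - q b)))\<^sup>2) has_sum s) B"
     "((\<lambda>b. (norm (E (q b)))\<^sup>2) has_sum t) B" by (auto simp: summable_on_def)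
  show "cfinite_dim (range (\<lambda>x. E (x - q x)))" "cfinite_dim (range (\<lambda>x. E (q x)))"
    using projection_trace_dim(1)[OF B projection_E_1q st(1)] projection_trace_dim(1)[OF B projection_E_q st(2)] .
  have e: "s - t = ess_codim p q"
    using projection_trace_dim(2)[OF B projection_E_1q st(1)] projection_trace_dim(2)[OF B projection_E_q st(2)]
    by (simp add: index_eq)
  have "(\<lambda>n. infsum (\<lambda>b. inner (C b) b) B) \<longlonglongrightarrow> infsum (\<lambda>b. (norm (E (b - q b)))\<^sup>2 - (norm (E (q b)))\<^sup>2) B"
  proof (rule dominated_convergence_has_sum(2)[OF weight_sum abs_weight sum])
    show "(\<lambda>n. weight (Suc n) b) \<longlonglongrightarrow> (norm (E (b - q b)))\<^sup>2 - (norm (E (q b)))\<^sup>2" for b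
      unfolding weight_def by (intro tendsto_diff LIMSEQ_Suc norm_pow_tendsto)
  qed
  then have "infsum (\<lambda>b. inner (C b) b) B = s - t"
    using infsumI[OF has_sum_diff[OF st]] by (simp add: LIMSEQ_const_iff)
  then show "((\<lambda>b. inner (C b) b) has_sum ess_codim p q) B"
    using weight_sum[of 0] e has_sum_cong[of B "weight 1" "\<lambda>b. inner (C b) b"] weight_1 by simp
qed

text \<open>
  The set \<open>q (ran p)\<close> is already the image of \<open>ran p \<inter> ker E\<close>, and there \<open>q\<close> is bounded below by
  the spectral gap.
\<close>

lemma closed_range: "closed (q ` range p)"
proof -
  obtain c where c: "c > 0"
    and gap: "\<And>x. E x = 0 \<Longrightarrow> c * (norm x)\<^sup>2 \<le> (norm x)\<^sup>2 - (norm (C x))\<^sup>2"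
    using spectral_gap[OF B sum] by blast
  let ?W = "{x. x - p x = 0} \<inter> {x. E x = 0}"
  have bE: "bounded_linear E" using fix_proj_projection by (simp add: projection_def bounded_clinear_def)
  have bp: "bounded_linear (\<lambda>x. x - p x)"
    by (intro bounded_linear_sub bounded_linear_ident bounded_linear_p)
  have "closed ?W"
    by (intro closed_Int closed_Collect_eq bounded_linear.continuous_on[OF bE] continuous_on_const
        bounded_linear.continuous_on[OF bp] continuous_on_id)
  moreover have "subspace ?W"
    by (intro subspace_inter linear_subspace_kernel bounded_linear.linear bE bp)
  moreover have "sqrt c * norm x \<le> norm (q x)" if "x \<in> ?W" for x
  proof -
    have "S x = - q x" using that by (simp add: S_def)
    then have "c * (norm x)\<^sup>2 \<le> (norm (q x))\<^sup>2"
      using gap[of x] that norm_C_S[of x] by simp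
    then have "sqrt (c * (norm x)\<^sup>2) \<le> sqrt ((norm (q x))\<^sup>2)" by (rule real_sqrt_le_mono)
    then show ?thesis by (simp add: real_sqrt_mult)
  qed
  ultimately have "complete (q ` ?W)"
    using c by (intro complete_isometric_image[of "sqrt c"] bounded_linear_q) (auto simp: complete_eq_closed)
  moreover have "q ` range p = q ` ?W"
  proof (intro equalityI subsetI)
    fix y assume "y \<in> q ` range p"
    then obtain x where y: "y = q (p x)" by blast
    have "p x - E (p x) \<in> ?W" by (simp add: additive idem E_commute fix_proj_diff fix_proj_idem)
    moreover have "y = q (p x - E (p x))" by (simp add: y additive q_E_p)
    ultimately show "y \<in> q ` ?W" by blast
  next
    fix y assume "y \<in> q ` ?W"
    then obtain x where "x \<in> ?W" "y = q x" by blast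
    then have "y = q (p x)" by simp
    then show "y \<in> q ` range p" by blast
  qed
  ultimately show ?thesis by (simp add: complete_eq_closed)
qed

lemma pair_fredholm: "fredholm_pair p q"
proof -
  have "bounded_clinear_on (range p) (range q) q"
    using bounded_linear.bounded[OF bounded_linear_q]
    by (auto simp: bounded_clinear_on_def additive scaleC mult.commute)
  moreover have "kernel_on (range q) (adjoint_on (range p) q) = {y \<in> range q. p y = 0}"
    unfolding kernel_on_def using adjoint_on_eq by auto
  ultimately show ?thesis
    unfolding fredholm_pair_def fredholm_on_def kernel_on_def[of "range p"]
    using kernel_finite_dim cokernel_finite_dim closed_range proj_p proj_q by (simp add: kernel_eq cokernel_eq)
qed

end

end

section \<open>Diagonals of projections\<close>

text \<open>
  For the second part, \<open>x\<close> is orthogonal to the closed span of \<open>A\<close>, hence to \<open>q x\<close>, and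
  \<open>\<langle>x, q x\<rangle> = \<parallel>q x\<parallel>\<^sup>2\<close>.
\<close>

lemma closure_span_projection:
  assumes q: "projection q" and r: "range q = closure (cspan A)"
  shows "x \<in> A \<Longrightarrow> q x = x" and "(\<And>a. a \<in> A \<Longrightarrow> cinner x a = 0) \<Longrightarrow> q x = 0"
proof -
  have idem: "q (q x) = q x" and sa: "cinner (q x) y = cinner x (q y)" for x y
    using q by (auto simp: projection_def)
  have fixed: "q a = a" if "a \<in> cspan A" for a
  proof -
    have "a \<in> range q" using that r closure_subset by blast
    then show ?thesis using idem by auto
  qed
  then show "x \<in> A \<Longrightarrow> q x = x" by (simp add: complex_vector.span_base)
  assume orth: "\<And>a. a \<in> A \<Longrightarrow> cinner x a = 0"
  have "cinner x a = 0" if "a \<in> cspan A" for a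
    using that by (induction rule: complex_vector.span_induct_alt)
      (auto simp: cinner_add_right cinner_scaleC_right orth)
  then have "cspan A \<subseteq> {a. inner x a = 0}" by (auto simp flip: Re_cinner)
  then have "closure (cspan A) \<subseteq> {a. inner x a = 0}"
    by (intro closure_minimal closed_Collect_eq continuous_intros)
  then have "inner x (q x) = 0" using r by blast
  moreover have "inner x (q x) = inner (q x) (q x)"
    by (simp flip: Re_cinner add: sa idem)
  ultimately show "q x = 0" by simp
qed

theorem theorem1p3:
  fixes e :: "'i \<Rightarrow> 'a::chilbert_space"
    and p q :: "'a \<Rightarrow> 'a"
    and d :: "'i \<Rightarrow> real"
    and a b :: real
  assumes "separable_space (euclidean :: 'a topology)"
    and "\<not> cfinite_dim (UNIV :: 'a set)"
    and "inj e" and "orthonormal_basis (range e)"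
    and "projection p"
    and "\<And>j. complex_of_real (d j) = cinner (p (e j)) (e j)"
    and "projection q" and "range q = closure (cspan {e j | j. d j > 1/2})"
    and "d summable_on {j. d j \<le> 1/2}"
    and "(\<lambda>j. 1 - d j) summable_on {j. d j > 1/2}"
    and "a = (\<Sum>\<^sub>\<infinity>j\<in>{j. d j \<le> 1/2}. d j)"
    and "b = (\<Sum>\<^sub>\<infinity>j\<in>{j. d j > 1/2}. 1 - d j)"
  shows "hilbert_schmidt (\<lambda>x. p x - q x) \<and>
         fredholm_pair p q \<and> a - b = real_of_int (ess_codim p q)"
proof -
  let ?L = "{j. d j \<le> 1/2}" and ?U = "{j. d j > 1/2}"
  interpret two_projections p q by unfold_locales fact+
  note on = orthonormal_basis_orthonormal[OF assms(4), unfolded orthonormal_def]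
  have qU: "q (e j) = e j" if "j \<in> ?U" for j
    using that by (intro closure_span_projection(1)[OF assms(7,8)]) auto
  have qL: "q (e j) = 0" if "j \<in> ?L" for j
  proof (rule closure_span_projection(2)[OF assms(7,8)])
    fix x assume "x \<in> {e j |j. d j > 1/2}"
    then obtain i where "x = e i" "d i > 1/2" by blast
    moreover from this that have "e j \<noteq> e i" using assms(3) by (auto dest: injD)
    ultimately show "cinner (e j) x = 0" using on by simp
  qed
  have LU: "?L \<union> ?U = UNIV" "?L \<inter> ?U = {}" by auto
  have d: "d j = inner (p (e j)) (e j)" "d j = (norm (p (e j)))\<^sup>2" for j
  proof -
    have "complex_of_real (d j) = complex_of_real ((norm (p (e j)))\<^sup>2)"
      using assms(6) projection_norm[OF assms(5)] by simp
    then show "d j = (norm (p (e j)))\<^sup>2" unfolding of_real_eq_iff .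
    show "d j = inner (p (e j)) (e j)" using assms(6)[of j] by (metis Re_cinner Re_complex_of_real)
  qed
  have one: "inner (e j) (e j) = 1" for j using on Re_cinner[of "e j" "e j"] by auto
  have CL: "(norm (C (e j)))\<^sup>2 = d j" "inner (C (e j)) (e j) = d j" if "j \<in> ?L" for j
    using qL[OF that] d[of j] by (simp_all add: C_def)
  have CU: "(norm (C (e j)))\<^sup>2 = 1 - d j" "inner (C (e j)) (e j) = - (1 - d j)" if "j \<in> ?U" for j
    using qU[OF that] d[of j] one[of j]
    by (simp_all add: C_def power2_norm_eq_inner inner_diff_left inner_diff_right inner_commute)
  have da: "(d has_sum a) ?L" and db: "((\<lambda>j. 1 - d j) has_sum b) ?U"
    using assms(9-12) by simp_all
  have "((\<lambda>j. (norm (C (e j)))\<^sup>2) has_sum a) ?L" "((\<lambda>j. (norm (C (e j)))\<^sup>2) has_sum b) ?U"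
    by (rule has_sum_cong[THEN iffD2, OF CL(1) da] has_sum_cong[THEN iffD2, OF CU(1) db]; assumption)+
  from has_sum_Un_disjoint[OF this LU(2)]
  have "((\<lambda>x. (norm (C x))\<^sup>2) has_sum (a + b)) (range e)"
    unfolding LU has_sum_reindex[OF assms(3)] o_def .
  then have sum: "(\<lambda>x. (norm (C x))\<^sup>2) summable_on (range e)" by (rule has_sum_imp_summable)
  have diag: "q x = x \<or> q x = 0" if "x \<in> range e" for x
  proof -
    from that obtain j where "x = e j" by blast
    then show ?thesis using qU[of j] qL[of j] by (cases "d j > 1/2") auto
  qed
  have "((\<lambda>j. inner (C (e j)) (e j)) has_sum a) ?L" "((\<lambda>j. inner (C (e j)) (e j)) has_sum (- b)) ?U"
    by (rule has_sum_cong[THEN iffD2, OF CL(2) da]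
          has_sum_cong[THEN iffD2, OF CU(2) has_sum_uminusI[OF db]]; assumption)+
  from has_sum_Un_disjoint[OF this LU(2)]
  have "((\<lambda>x. inner (C x) x) has_sum (a + - b)) (range e)"
    unfolding LU has_sum_reindex[OF assms(3)] o_def .
  then have "a - b = ess_codim p q"
    using has_sum_unique[OF _ diagonal_sum_eq_ess_codim[OF assms(4) diag sum]] by simp
  moreover have "hilbert_schmidt (\<lambda>x. p x - q x)"
    using bounded_clinear_C sum assms(4) unfolding hilbert_schmidt_def C_def by blast
  ultimately show ?thesis using pair_fredholm[OF assms(4) diag sum] by simp
qed

end
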